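(* Let $m \ge 2$ be an integer and let $\lambda > 0$ satisfy $\lambda^m + \lambda^{m-1} + \cdots + \lambda = 1$. Then for every $\alpha > 1$, the Hausdorff dimension of $W_\lambda(\alpha)$ equals $-\frac{\log\lambda}{\log 2}\cdot\frac{1}{\alpha}$.
   Context: For $\lambda\in(\tfrac12,1)$ let $I_\lambda = [0,\lambda/(1-\lambda)]$ and $$W_\lambda(\alpha) = \bigcap_{m'\in\mathbb{N}}\bigcup_{n\ge m'}\bigcup_{\omega\in\{0,1\}^n}\Big\{x\in I_\lambda : \Big|x-\sum_{i=1}^n\omega_i\lambda^i\Big| < 2^{-n\alpha}\Big\}.$$ Such $\lambda$ (multinacci numbers) lie in $(\tfrac12,1)$ when $m\ge 2$. *)

theory Defs
  imports "HOL-Analysis.Analysis"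
begin

(* The power diam(U)^s with the conventions of geometric measure theory: the empty set
   contributes 0, and 0^0 = 1, so that the case s = 0 is counting measure.  The case
   distinction is needed because 0 powr 0 = 0 in HOL. *)
definition diam_powr :: "real \<Rightarrow> 'a::metric_space set \<Rightarrow> ennreal" where
  "diam_powr s U =
     (if U = {} then 0 else if s = 0 then 1 else ennreal (diameter U powr s))"

(* Boundedness is explicit because diameter is an unspecified real on unbounded sets.
   Sequences of sets also represent finite covers, by padding with empty sets. *)
definition delta_covers :: "real \<Rightarrow> 'a::metric_space set \<Rightarrow> (nat \<Rightarrow> 'a set) set" where
  "delta_covers \<delta> A =
     {U. A \<subseteq> (\<Union>i. U i) \<and> (\<forall>i. bounded (U i) \<and> diameter (U i) \<le> \<delta>)}"

definition hausdorff_pre_measure :: "real \<Rightarrow> real \<Rightarrow> 'a::metric_space set \<Rightarrow> ennreal" where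
  "hausdorff_pre_measure s \<delta> A = (INF U\<in>delta_covers \<delta> A. \<Sum>i. diam_powr s (U i))"

definition hausdorff_measure :: "real \<Rightarrow> 'a::metric_space set \<Rightarrow> ennreal" where
  "hausdorff_measure s A = (SUP \<delta>\<in>{0<..}. hausdorff_pre_measure s \<delta> A)"

definition hausdorff_dim :: "'a::metric_space set \<Rightarrow> ereal" where
  "hausdorff_dim A = Inf {ereal s |s. 0 \<le> s \<and> hausdorff_measure s A = 0}"

definition I_set :: "real \<Rightarrow> real set" where
  "I_set lam = {0..lam / (1 - lam)}"

(* A word of length n over {0,1} is a function on the index set {1..n}. *)
definition W_set :: "real \<Rightarrow> real \<Rightarrow> real set" where
  "W_set lam \<alpha> =
     (\<Inter>m'::nat. \<Union>n\<in>{m'..}. \<Union>\<omega>\<in>{1..n} \<rightarrow>\<^sub>E {0, 1::nat}.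
        {x \<in> I_set lam.
           \<bar>x - (\<Sum>i=1..n. real (\<omega> i) * lam ^ i)\<bar> < 2 powr (- (real n * \<alpha>))})"

end

theory Submission
  imports Defs
begin

text \<open>
  Write \<open>S\<^sub>n\<close> for the set of values of words of length \<open>n\<close>. Since \<open>0 1\<^sup>m\<close> and \<open>1 0\<^sup>m\<close> have the same value,
  \<open>S\<^sub>n\<close> has at most \<open>\<lambda>\<^sup>-\<^sup>n / (1 - \<lambda>)\<close> elements, and covering by the balls of radius \<open>2\<^sup>-\<^sup>n\<^sup>\<alpha>\<close> gives
  the upper bound. For the lower bound only the density of \<open>S\<^sub>n\<close> at scale \<open>\<lambda>\<^sup>n\<close> matters. Given a cover
  by sets of small total \<open>s\<close>-weight, nested intervals of radii \<open>2\<^sup>-\<^sup>n\<^sup>\<alpha> / 2\<close> around points of \<open>S\<^sub>n\<close>,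
  for a rapidly growing sequence of \<open>n\<close>, are chosen so that each interval of length \<open>r\<close>
  misses all covering sets larger than \<open>r\<close>, and the smaller ones that it meets have total weight at most
  \<open>r\<^sup>s / 16\<close>; an averaging argument provides the next interval. The common point lies in \<open>W\<close> but in no
  covering set. No mass distribution is needed.
\<close>

section \<open>Values of words and their density\<close>

text \<open>A set of values rather than a family over words: words of equal value count once, which
  the cardinality bound exploits.\<close>

definition digit_sums :: "real \<Rightarrow> nat \<Rightarrow> real set" where
  "digit_sums lam n = (\<lambda>\<omega>. \<Sum>i=1..n. real (\<omega> i) * lam ^ i) ` ({1..n} \<rightarrow>\<^sub>E {0, 1::nat})"

lemma mem_W_set:
  "x \<in> W_set lam \<alpha> \<longleftrightarrow> (\<forall>m'. \<exists>n\<ge>m'. x \<in> I_set lam \<and>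
     (\<exists>y\<in>digit_sums lam n. \<bar>x - y\<bar> < 2 powr (- (real n * \<alpha>))))"
  unfolding W_set_def digit_sums_def by (simp add: Bex_def) blast

lemma digit_sumsI:
  assumes "\<And>i. \<omega> i \<in> {0, 1::nat}"
  shows "(\<Sum>i=1..n. real (\<omega> i) * lam ^ i) \<in> digit_sums lam n"
  unfolding digit_sums_def
proof (rule image_eqI)
  show "(\<Sum>i=1..n. real (\<omega> i) * lam ^ i) = (\<Sum>i=1..n. real (restrict \<omega> {1..n} i) * lam ^ i)"
    by simp
  show "restrict \<omega> {1..n} \<in> {1..n} \<rightarrow>\<^sub>E {0, 1::nat}" using assms by auto
qed

lemma digit_sumsE:
  assumes "x \<in> digit_sums lam n"
  obtains \<omega> where "\<And>i. \<omega> i \<in> {0, 1::nat}" "x = (\<Sum>i=1..n. real (\<omega> i) * lam ^ i)"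
proof -
  obtain \<omega> where w: "\<omega> \<in> {1..n} \<rightarrow>\<^sub>E {0, 1::nat}" "x = (\<Sum>i=1..n. real (\<omega> i) * lam ^ i)"
    using assms by (auto simp: digit_sums_def)
  show thesis
  proof (rule that)
    show "(if i \<in> {1..n} then \<omega> i else 0) \<in> {0, 1}" for i using w(1) by (auto simp: PiE_def Pi_def)
    show "x = (\<Sum>i=1..n. real (if i \<in> {1..n} then \<omega> i else 0) * lam ^ i)" using w(2) by simp
  qed
qed

lemma digit_sums_0: "digit_sums lam 0 = {0}"
  by (auto simp: digit_sums_def)

text \<open>Splitting off the first digit leaves a tail that is a word of length \<open>n\<close>
  scaled by \<open>lam\<close>. Density and normal form rest on this recursion.\<close>

lemma digit_sums_Suc:
  "digit_sums lam (Suc n) = (\<lambda>x. lam * x) ` digit_sums lam n \<union> (\<lambda>x. lam + lam * x) ` digit_sums lam n"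
  (is "?L = ?A \<union> ?B")
proof -
  have shift: "(\<Sum>i=1..Suc n. real (\<omega> i) * lam ^ i) =
      real (\<omega> 1) * lam + lam * (\<Sum>i=1..n. real (\<omega> (Suc i)) * lam ^ i)" for \<omega> :: "nat \<Rightarrow> nat"
  proof -
    have "(\<Sum>i=1..Suc n. real (\<omega> i) * lam ^ i) =
        real (\<omega> 1) * lam + (\<Sum>i=Suc 1..Suc n. real (\<omega> i) * lam ^ i)"
      by (subst sum.atLeast_Suc_atMost) auto
    also have "(\<Sum>i=Suc 1..Suc n. real (\<omega> i) * lam ^ i) = (\<Sum>i=1..n. real (\<omega> (Suc i)) * lam ^ Suc i)"
      by (rule sum.shift_bounds_cl_Suc_ivl)
    finally show ?thesis by (simp add: sum_distrib_left mult_ac)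
  qed
  show ?thesis
  proof
    show "?L \<subseteq> ?A \<union> ?B"
    proof
      fix x assume "x \<in> ?L"
      then obtain \<omega> where w: "\<And>i. \<omega> i \<in> {0, 1::nat}" "x = (\<Sum>i=1..Suc n. real (\<omega> i) * lam ^ i)"
        by (rule digit_sumsE) blast
      let ?y = "\<Sum>i=1..n. real (\<omega> (Suc i)) * lam ^ i"
      have "?y \<in> digit_sums lam n" by (intro digit_sumsI w(1))
      moreover have "x = lam * ?y \<or> x = lam + lam * ?y"
        using w(1)[of 1] unfolding w(2) shift by auto
      ultimately show "x \<in> ?A \<union> ?B" by blast
    qed
    have "real b * lam + lam * y \<in> ?L" if "y \<in> digit_sums lam n" "b \<in> {0, 1}" for b y
    proof -
      obtain \<omega> where w: "\<And>i. \<omega> i \<in> {0, 1::nat}" "y = (\<Sum>i=1..n. real (\<omega> i) * lam ^ i)"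
        using \<open>y \<in> digit_sums lam n\<close> by (rule digit_sumsE) blast
      let ?w = "\<lambda>i. if i = 1 then b else \<omega> (i - 1)"
      have "(\<Sum>i=1..n. real (?w (Suc i)) * lam ^ i) = y"
        unfolding w(2) by (intro sum.cong) auto
      then have "real b * lam + lam * y = (\<Sum>i=1..Suc n. real (?w i) * lam ^ i)"
        unfolding shift by simp
      also have "\<dots> \<in> ?L" using w(1) that(2) by (intro digit_sumsI) auto
      finally show ?thesis .
    qed
    from this[of _ 0] this[of _ 1] show "?A \<union> ?B \<subseteq> ?L" by auto
  qed
qed

text \<open>With \<open>L = lam / (1 - lam)\<close>, the two maps of the recursion send
  \<open>{0..L}\<close> onto \<open>{0..lam * L}\<close> and \<open>{lam..L}\<close>. These cover
  \<open>{0..L}\<close> because \<open>lam \<ge> 1 / 2\<close> means \<open>L \<ge> 1\<close>, and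
  each step shrinks the error by \<open>lam\<close>.\<close>

lemma digit_sums_dense:
  fixes lam :: real
  assumes "1 / 2 \<le> lam" "lam < 1" "0 \<le> x" "x \<le> lam / (1 - lam)"
  shows "\<exists>y\<in>digit_sums lam n. \<bar>x - y\<bar> \<le> lam / (1 - lam) * lam ^ n"
  using assms(3,4)
proof (induction n arbitrary: x)
  case 0
  then show ?case by (auto simp: digit_sums_0)
next
  case (Suc n)
  define L where "L = lam / (1 - lam)"
  have L: "L = lam + lam * L" "1 \<le> L" using assms(1,2) by (auto simp: L_def field_simps)
  have *: "\<exists>y\<in>digit_sums lam (Suc n). \<bar>x - y\<bar> \<le> L * lam ^ Suc n"
    if x': "0 \<le> x'" "x' \<le> L" "x = c + lam * x'" "c = 0 \<or> c = lam" for x' c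
  proof -
    obtain y where y: "y \<in> digit_sums lam n" "\<bar>x' - y\<bar> \<le> L * lam ^ n"
      using Suc.IH[of x'] x'(1,2) unfolding L_def by blast
    have "x - (c + lam * y) = lam * (x' - y)" using x' by (simp add: algebra_simps)
    then have "\<bar>x - (c + lam * y)\<bar> = lam * \<bar>x' - y\<bar>" using assms(1) by (simp add: abs_mult)
    also have "\<dots> \<le> lam * (L * lam ^ n)" using y(2) assms(1) by (intro mult_left_mono) auto
    finally have "\<bar>x - (c + lam * y)\<bar> \<le> L * lam ^ Suc n" by (simp add: mult_ac)
    moreover have "c + lam * y \<in> digit_sums lam (Suc n)"
      using x'(4) y(1) by (auto simp: digit_sums_Suc)
    ultimately show ?thesis by blast
  qed
  have "lam > 0" using assms(1) by simp
  show ?case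
  proof (cases "x \<le> lam * L")
    case True
    then show ?thesis using *[of "x / lam" 0] Suc.prems \<open>lam > 0\<close>
      unfolding L_def by (simp add: field_simps)
  next
    case False
    then have "lam \<le> x" using L(2) \<open>lam > 0\<close> mult_left_mono[of 1 L lam] by linarith
    moreover have "(x - lam) / lam \<le> L"
      using Suc.prems(2) L(1) \<open>lam > 0\<close> by (simp add: L_def[symmetric] pos_divide_le_eq mult.commute)
    ultimately show ?thesis using *[of "(x - lam) / lam" lam] \<open>lam > 0\<close>
      unfolding L_def by (simp add: field_simps)
  qed
qed

section \<open>Counting the values by a normal form of words\<close>

text \<open>The values of the words of length \<open>n\<close> that are concatenations of blocks \<open>0 1\<^sup>j\<close> with \<open>j < m\<close>.\<close>

function block_sums :: "real \<Rightarrow> nat \<Rightarrow> nat \<Rightarrow> real set" where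
  "block_sums lam m n = (if n = 0 then {0} else
     (\<Union>j\<in>{1..min m n}. (\<lambda>u. lam * (\<Sum>i=1..j-1. lam ^ i) + lam ^ j * u) ` block_sums lam m (n - j)))"
  by pat_completeness auto
termination by (relation "Wellfounded.measure (\<lambda>(_, _, n). n)") auto

declare block_sums.simps [simp del]

lemma finite_block_sums: "finite (block_sums lam m n)"
proof (induction n rule: less_induct)
  case (less n)
  then show ?case by (subst block_sums.simps) auto
qed

text \<open>Choosing the first block bounds the count at \<open>n\<close> by the sum of the counts
  at \<open>n - j\<close>; powers of \<open>1 / lam\<close> respect this recursion because the
  powers of \<open>lam\<close> up to \<open>m\<close> sum to 1.\<close>

lemma card_block_sums:
  assumes "lam > 0" "(\<Sum>k=1..m. lam ^ k) = 1"
  shows "real (card (block_sums lam m n)) \<le> (1 / lam) ^ n"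
proof (induction n rule: less_induct)
  case (less n)
  show ?case
  proof (cases "n = 0")
    case True
    then show ?thesis by (simp add: block_sums.simps)
  next
    case False
    then have "card (block_sums lam m n) \<le> (\<Sum>j\<in>{1..min m n}. card
        ((\<lambda>u. lam * (\<Sum>i=1..j-1. lam ^ i) + lam ^ j * u) ` block_sums lam m (n - j)))"
      by (subst block_sums.simps) (simp add: card_UN_le)
    also have "\<dots> \<le> (\<Sum>j\<in>{1..min m n}. card (block_sums lam m (n - j)))"
      by (intro sum_mono card_image_le finite_block_sums)
    finally have "real (card (block_sums lam m n)) \<le> (\<Sum>j\<in>{1..min m n}. real (card (block_sums lam m (n - j))))"
      by (metis of_nat_le_iff of_nat_sum)
    also have "\<dots> \<le> (\<Sum>j\<in>{1..min m n}. (1 / lam) ^ (n - j))"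
      using less False by (intro sum_mono) auto
    also have "\<dots> = (\<Sum>j\<in>{1..min m n}. (1 / lam) ^ n * lam ^ j)"
      using assms(1) by (intro sum.cong) (auto simp: power_diff power_one_over field_simps)
    also have "\<dots> \<le> (\<Sum>j\<in>{1..m}. (1 / lam) ^ n * lam ^ j)"
      using assms(1) by (intro sum_mono2) auto
    also have "\<dots> = (1 / lam) ^ n" using assms(2) by (simp flip: sum_distrib_left)
    finally show ?thesis .
  qed
qed

lemma ones_append_digit_sums:
  assumes "u \<in> digit_sums lam n"
  shows "(\<Sum>i=1..j. lam ^ i) + lam ^ j * u \<in> digit_sums lam (j + n)"
proof (induction j)
  case 0
  then show ?case using assms by simp
next
  case (Suc j)
  have "(\<Sum>i=1..Suc j. lam ^ i) = lam + lam * (\<Sum>i=1..j. lam ^ i)"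
  proof -
    have "(\<Sum>i=1..Suc j. lam ^ i) = lam + (\<Sum>i=Suc 1..Suc j. lam ^ i)"
      by (subst sum.atLeast_Suc_atMost) auto
    also have "(\<Sum>i=Suc 1..Suc j. lam ^ i) = (\<Sum>i=1..j. lam ^ Suc i)"
      by (rule sum.shift_bounds_cl_Suc_ivl)
    finally show ?thesis by (simp add: sum_distrib_left)
  qed
  then have "(\<Sum>i=1..Suc j. lam ^ i) + lam ^ Suc j * u =
      lam + lam * ((\<Sum>i=1..j. lam ^ i) + lam ^ j * u)" by (simp add: algebra_simps)
  also have "\<dots> \<in> digit_sums lam (Suc (j + n))"
    unfolding digit_sums_Suc using Suc by blast
  finally show ?case by simp
qed

lemma zeros_append_digit_sums:
  assumes "u \<in> digit_sums lam n"
  shows "lam ^ j * u \<in> digit_sums lam (j + n)"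
  using assms by (induction j) (auto simp: digit_sums_Suc mult.assoc)

lemma block_sums_subset: "block_sums lam m n \<subseteq> digit_sums lam n"
proof (induction n rule: less_induct)
  case (less n)
  show ?case
  proof (cases "n = 0")
    case True
    then show ?thesis by (simp add: block_sums.simps digit_sums_0)
  next
    case False
    \<comment> \<open>\<open>j\<close> is the length of the first block: a 0 followed by
      \<open>j - 1\<close> ones.\<close>
    have "lam * (\<Sum>i=1..j-1. lam ^ i) + lam ^ j * u \<in> digit_sums lam n"
      if "j \<in> {1..min m n}" "u \<in> block_sums lam m (n - j)" for j u
    proof -
      have "u \<in> digit_sums lam (n - j)" using less[of "n - j"] that by auto
      from ones_append_digit_sums[OF this, of "j - 1"] that(1)
      have "(\<Sum>i=1..j-1. lam ^ i) + lam ^ (j - 1) * u \<in> digit_sums lam (n - 1)" by simp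
      then have "lam * ((\<Sum>i=1..j-1. lam ^ i) + lam ^ (j - 1) * u) \<in> digit_sums lam (Suc (n - 1))"
        unfolding digit_sums_Suc by blast
      moreover have "lam ^ j = lam * lam ^ (j - 1)" using that(1) by (cases j) auto
      ultimately show ?thesis using False by (simp add: algebra_simps)
    qed
    then show ?thesis using False by (subst block_sums.simps) auto
  qed
qed

text \<open>Since \<open>0 1\<^sup>m\<close> and \<open>1 0\<^sup>m\<close> have the same value, every word can be rewritten as a run of ones
  followed by blocks.\<close>

lemma digit_sums_normal_form:
  assumes m: "(\<Sum>k=1..m. lam ^ k) = 1"
  shows "digit_sums lam n \<subseteq> (\<Union>j\<le>n. (\<lambda>u. (\<Sum>i=1..j. lam ^ i) + lam ^ j * u) ` block_sums lam m (n - j))"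
proof (induction n)
  case 0
  then show ?case by (simp add: digit_sums_0 block_sums.simps)
next
  case (Suc n)
  let ?N = "\<lambda>n. \<Union>j\<le>n. (\<lambda>u. (\<Sum>i=1..j. lam ^ i) + lam ^ j * u) ` block_sums lam m (n - j)"
  have split: "(\<Sum>i=1..a+b. lam ^ i) = (\<Sum>i=1..a. lam ^ i) + lam ^ a * (\<Sum>i=1..b. lam ^ i)" for a b
    by (induction b) (auto simp: algebra_simps power_add)
  have one: "lam + lam * x \<in> ?N (Suc n)" if x: "x \<in> digit_sums lam n" for x
  proof -
    from x Suc obtain j u where ju: "j \<le> n" "u \<in> block_sums lam m (n - j)"
      "x = (\<Sum>i=1..j. lam ^ i) + lam ^ j * u" by blast
    have "lam + lam * x = (\<Sum>i=1..Suc j. lam ^ i) + lam ^ Suc j * u"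
      unfolding ju(3) using split[of 1 j] by (simp add: algebra_simps)
    then show ?thesis using ju(1,2) by (intro UN_I[of "Suc j"]) auto
  qed
  have zero: "lam * x \<in> ?N (Suc n)" if x: "x \<in> digit_sums lam n" for x
  proof -
    from x Suc obtain j u where ju: "j \<le> n" "u \<in> block_sums lam m (n - j)"
      "x = (\<Sum>i=1..j. lam ^ i) + lam ^ j * u" by blast
    show ?thesis
    proof (cases "j < m")
      case True
      \<comment> \<open>A 0 before a run of fewer than \<open>m\<close> ones is a block of length
        \<open>Suc j \<le> m\<close>.\<close>
      have "lam * x = lam * (\<Sum>i=1..Suc j-1. lam ^ i) + lam ^ Suc j * u"
        unfolding ju(3) by (simp add: algebra_simps)
      then have "lam * x \<in> (\<lambda>u. lam * (\<Sum>i=1..Suc j-1. lam ^ i) + lam ^ Suc j * u) `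
          block_sums lam m (Suc n - Suc j)" using ju(2) by auto
      moreover have "Suc j \<in> {1..min m (Suc n)}" using ju(1) True by simp
      ultimately have "lam * x \<in> block_sums lam m (Suc n)"
        unfolding block_sums.simps[of lam m "Suc n"] if_not_P[OF nat.simps(3)] by (rule UN_I[rotated])
      then show ?thesis by (intro UN_I[of 0]) auto
    next
      case False
      \<comment> \<open>Exchanging the prefix \<open>0 1^m\<close> for \<open>1 0^m\<close> leaves,
        after the leading 1, the word \<open>0^m 1^(j-m)\<close> followed by \<open>u\<close>, of
        value \<open>?y\<close>. It has length \<open>n\<close>, so \<open>one\<close>, and with it
        the induction hypothesis, applies.\<close>
      let ?y = "lam ^ m * ((\<Sum>i=1..j-m. lam ^ i) + lam ^ (j - m) * u)"
      have "u \<in> digit_sums lam (n - j)" using ju(2) block_sums_subset by blast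
      from zeros_append_digit_sums[OF ones_append_digit_sums[OF this, of "j - m"], of m]
      have y: "?y \<in> digit_sums lam n" using False ju(1) by simp
      have "lam ^ m * lam ^ (j - m) = lam ^ j" using False by (simp flip: power_add)
      then have "lam * x = lam + lam * ?y"
        unfolding ju(3) using split[of m "j - m"] m False by (simp add: algebra_simps)
      then show ?thesis using one[OF y] by simp
    qed
  qed
  show ?case unfolding digit_sums_Suc using one zero by blast
qed

lemma finite_digit_sums: "finite (digit_sums lam n)"
  unfolding digit_sums_def by (intro finite_imageI finite_PiE) auto

text \<open>After a run of \<open>j\<close> ones at most \<open>(1 / lam) ^ (n - j)\<close> values
  remain; the sum over \<open>j\<close> is geometric and costs only a constant factor.\<close>

lemma card_digit_sums:
  assumes "0 < lam" "lam < 1" "(\<Sum>k=1..m. lam ^ k) = 1"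
  shows "real (card (digit_sums lam n)) \<le> (1 / lam) ^ n / (1 - lam)"
proof -
  let ?f = "\<lambda>j. (\<lambda>u. (\<Sum>i=1..j. lam ^ i) + lam ^ j * u) ` block_sums lam m (n - j)"
  have "card (digit_sums lam n) \<le> card (\<Union>j\<le>n. ?f j)"
    by (intro card_mono digit_sums_normal_form assms) (auto simp: finite_block_sums)
  also have "\<dots> \<le> (\<Sum>j\<le>n. card (?f j))" by (rule card_UN_le) simp
  also have "\<dots> \<le> (\<Sum>j\<le>n. card (block_sums lam m (n - j)))"
    by (intro sum_mono card_image_le finite_block_sums)
  finally have "real (card (digit_sums lam n)) \<le> (\<Sum>j\<le>n. real (card (block_sums lam m (n - j))))"
    by (metis of_nat_le_iff of_nat_sum)
  also have "\<dots> \<le> (\<Sum>j\<le>n. (1 / lam) ^ (n - j))"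
    by (intro sum_mono card_block_sums assms)
  also have "\<dots> = (\<Sum>j\<le>n. (1 / lam) ^ n * lam ^ j)"
    using assms(1) by (intro sum.cong) (auto simp: power_diff power_one_over field_simps)
  also have "\<dots> = (1 / lam) ^ n * (\<Sum>j\<le>n. lam ^ j)" by (simp add: sum_distrib_left)
  also have "(\<Sum>j\<le>n. lam ^ j) \<le> 1 / (1 - lam)"
    using assms sum_le_suminf[of "\<lambda>j. lam ^ j" "{..n}"]
    by (simp add: summable_geometric suminf_geometric)
  finally show ?thesis using assms(1) by (simp add: mult_left_mono)
qed

section \<open>Upper bound for the dimension\<close>

lemma hausdorff_measure_eq_0I:
  assumes "\<And>\<delta> e. \<delta> > 0 \<Longrightarrow> e > 0 \<Longrightarrow> \<exists>U\<in>delta_covers \<delta> A. (\<Sum>i. diam_powr s (U i)) \<le> ennreal e"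
  shows "hausdorff_measure s A = 0"
proof -
  have "hausdorff_pre_measure s \<delta> A = 0" if "\<delta> > 0" for \<delta>
  proof -
    have "hausdorff_pre_measure s \<delta> A \<le> 0 + ennreal e" if "e > 0" for e
    proof -
      obtain U where "U \<in> delta_covers \<delta> A" "(\<Sum>i. diam_powr s (U i)) \<le> ennreal e"
        using assms[OF \<open>\<delta> > 0\<close> \<open>e > 0\<close>] by blast
      then show ?thesis unfolding hausdorff_pre_measure_def by (auto intro: INF_lower2)
    qed
    then have "hausdorff_pre_measure s \<delta> A \<le> 0" by (rule ennreal_le_epsilon)
    then show ?thesis by simp
  qed
  then show ?thesis unfolding hausdorff_measure_def by simp
qed

text \<open>A Borel-Cantelli argument: the balls of all levels from \<open>M\<close> on cover the
  set, and the weight of a level is at most a constant times a power of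
  \<open>2 powr (- (\<alpha> * s)) / lam\<close>, so the tail of the series is small.\<close>

lemma hausdorff_measure_W_set_eq_0:
  assumes lam: "0 < lam" "lam < 1" "(\<Sum>k=1..m. lam ^ k) = 1"
    and "\<alpha> > 0" "s > 0" and q: "2 powr (- (\<alpha> * s)) / lam < 1"
  shows "hausdorff_measure s (W_set lam \<alpha>) = 0"
proof (rule hausdorff_measure_eq_0I)
  fix \<delta> e :: real assume "\<delta> > 0" "e > 0"
  define q where "q = 2 powr (- (\<alpha> * s)) / lam"
  define c where "c = 2 powr s / (1 - lam)"
  have q: "0 < q" "q < 1" using q lam by (auto simp: q_def)
  have c: "0 < c" using lam by (simp add: c_def)
  define \<rho> where "\<rho> n = 2 powr (- (real n * \<alpha>))" for n
  have "(\<lambda>M. c * q ^ M / (1 - q)) \<longlonglongrightarrow> c * 0 / (1 - q)"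
    using q by (intro tendsto_intros LIMSEQ_realpow_zero) auto
  then have "eventually (\<lambda>M. c * q ^ M / (1 - q) < e) sequentially"
    using \<open>e > 0\<close> by (intro order_tendstoD) auto
  moreover have "(\<lambda>M. 2 * (2 powr (- \<alpha>)) ^ M) \<longlonglongrightarrow> 2 * 0"
    using \<open>\<alpha> > 0\<close> by (intro tendsto_intros LIMSEQ_realpow_zero) (auto simp: powr_less_one)
  then have "eventually (\<lambda>M. 2 * (2 powr (- \<alpha>)) ^ M < \<delta>) sequentially"
    using \<open>\<delta> > 0\<close> by (intro order_tendstoD) auto
  ultimately have "eventually (\<lambda>M. c * q ^ M / (1 - q) < e \<and> 2 * (2 powr (- \<alpha>)) ^ M < \<delta>) sequentially"
    by eventually_elim auto
  then obtain M where M: "c * q ^ M / (1 - q) < e" "2 * (2 powr (- \<alpha>)) ^ M < \<delta>"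
    by (auto simp: eventually_sequentially)
  have \<rho>_le: "2 * \<rho> (n + M) \<le> \<delta>" for n
  proof -
    have "\<rho> (n + M) \<le> \<rho> M" unfolding \<rho>_def using \<open>\<alpha> > 0\<close> by (intro powr_mono) auto
    moreover have "\<rho> M = (2 powr (- \<alpha>)) ^ M"
      by (simp add: \<rho>_def powr_power mult.commute)
    ultimately show ?thesis using M(2) by simp
  qed
  let ?S = "digit_sums lam"
  have "\<forall>n. \<exists>h. bij_betw h {0..<card (?S n)} (?S n)"
    using ex_bij_betw_nat_finite[OF finite_digit_sums] by blast
  then obtain h where h: "\<And>n. bij_betw (h n) {0..<card (?S n)} (?S n)" by metis
  \<comment> \<open>Padding each level with empty sets, which weigh 0, lets the pairs range over all
    naturals, so that \<open>prod_decode\<close> turns them into one sequence.\<close>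
  define V where "V = (\<lambda>(n, j). if j < card (?S (n + M)) then ball (h (n + M) j) (\<rho> (n + M)) else {})"
  have diam: "diameter (V (n, j)) \<le> 2 * \<rho> (n + M)" for n j
  proof (rule diameter_le)
    show "V (n, j) \<noteq> {} \<or> 0 \<le> 2 * \<rho> (n + M)" by (simp add: \<rho>_def)
    show "norm (x - y) \<le> 2 * \<rho> (n + M)" if "x \<in> V (n, j)" "y \<in> V (n, j)" for x y
      using that by (auto simp: V_def dist_real_def split: if_splits)
  qed
  have bdd: "bounded (V p)" for p by (auto simp: V_def split: prod.split)
  have "W_set lam \<alpha> \<subseteq> (\<Union>i. V (prod_decode i))"
  proof
    fix x assume "x \<in> W_set lam \<alpha>"
    then obtain k y where k: "k \<ge> M" "y \<in> ?S k" "\<bar>x - y\<bar> < \<rho> k"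
      unfolding mem_W_set \<rho>_def by blast
    obtain j where j: "j < card (?S k)" "y = h k j"
      using k(2) bij_betw_imp_surj_on[OF h[of k]] by (metis imageE atLeastLessThan_iff)
    have "x \<in> V (k - M, j)" using k j by (auto simp: V_def dist_real_def abs_minus_commute)
    then have "x \<in> V (prod_decode (prod_encode (k - M, j)))" by simp
    then show "x \<in> (\<Union>i. V (prod_decode i))" by blast
  qed
  moreover have "diameter (V p) \<le> \<delta>" for p
    using order_trans[OF diam \<rho>_le, of "fst p" "snd p"] by simp
  ultimately have "(\<lambda>i. V (prod_decode i)) \<in> delta_covers \<delta> (W_set lam \<alpha>)"
    using bdd by (auto simp: delta_covers_def)
  moreover have "(\<Sum>i. diam_powr s (V (prod_decode i))) \<le> ennreal e"
  proof -
    have level: "(\<Sum>j. diam_powr s (V (n, j))) \<le> ennreal (c * q ^ (n + M))" for n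
    proof -
      have "(\<Sum>j. diam_powr s (V (n, j))) = (\<Sum>j<card (?S (n + M)). diam_powr s (V (n, j)))"
        by (rule suminf_finite) (auto simp: V_def diam_powr_def)
      also have "\<dots> \<le> (\<Sum>j<card (?S (n + M)). ennreal ((2 * \<rho> (n + M)) powr s))"
      proof (rule sum_mono)
        fix j
        have "diameter (V (n, j)) powr s \<le> (2 * \<rho> (n + M)) powr s"
          using diam \<open>s > 0\<close> by (intro powr_mono2) (auto intro: diameter_ge_0 bdd)
        then show "diam_powr s (V (n, j)) \<le> ennreal ((2 * \<rho> (n + M)) powr s)"
          using \<open>s > 0\<close> by (auto simp: diam_powr_def ennreal_leI)
      qed
      also have "\<dots> = ennreal (real (card (?S (n + M))) * (2 * \<rho> (n + M)) powr s)"
        by (simp add: ennreal_mult ennreal_of_nat_eq_real_of_nat)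
      also have "\<dots> \<le> ennreal (((1 / lam) ^ (n + M) / (1 - lam)) * (2 * \<rho> (n + M)) powr s)"
        by (intro ennreal_leI mult_right_mono card_digit_sums[OF lam]) auto
      also have "(2 * \<rho> (n + M)) powr s = 2 powr s * (2 powr (- (\<alpha> * s))) ^ (n + M)"
        by (simp add: \<rho>_def powr_mult powr_powr powr_power mult_ac)
      also have "((1 / lam) ^ (n + M) / (1 - lam)) * \<dots> = c * q ^ (n + M)"
        by (simp add: c_def q_def power_divide)
      finally show ?thesis .
    qed
    have "(\<Sum>i. diam_powr s (V (prod_decode i))) = (\<Sum>n. \<Sum>j. diam_powr s (V (n, j)))"
      by (rule suminf_ennreal_2dimen[of _ "\<lambda>p. diam_powr s (V p)"]) simp
    also have "\<dots> \<le> (\<Sum>n. ennreal (c * q ^ (n + M)))"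
      using level by (intro suminf_le) auto
    also have "\<dots> = ennreal (c * q ^ M / (1 - q))"
    proof (rule suminf_ennreal_eq)
      show "0 \<le> c * q ^ (n + M)" for n using q c by simp
      have "(\<lambda>n. c * q ^ M * q ^ n) sums (c * q ^ M * (1 / (1 - q)))"
        using q by (intro sums_mult geometric_sums) auto
      then show "(\<lambda>n. c * q ^ (n + M)) sums (c * q ^ M / (1 - q))"
        by (simp add: power_add mult_ac)
    qed
    also have "\<dots> \<le> ennreal e" using M(1) by (intro ennreal_leI) simp
    finally show ?thesis .
  qed
  ultimately show "\<exists>U\<in>delta_covers \<delta> (W_set lam \<alpha>). (\<Sum>i. diam_powr s (U i)) \<le> ennreal e"
    by (intro bexI[where x="\<lambda>i. V (prod_decode i)"])
qed

section \<open>Lower bound for the dimension\<close>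

text \<open>For sets of diameter at most 1 the \<open>t\<close>-weight does not exceed the
  \<open>s\<close>-weight. Passing to \<open>t > s\<close> makes the exponent positive even when
  \<open>s = 0\<close>.\<close>

lemma hausdorff_measure_eq_0D:
  assumes A: "hausdorff_measure s A = 0" "0 \<le> s" "s < t" "e > 0" "e \<le> 1"
  obtains U d where "A \<subseteq> (\<Union>i. U i)" "\<And>i. d i > 0" "\<And>i x y. x \<in> U i \<Longrightarrow> y \<in> U i \<Longrightarrow> dist x y \<le> d i"
    "summable (\<lambda>i. d i powr t)" "(\<Sum>i. d i powr t) \<le> e"
proof -
  have "hausdorff_pre_measure s 1 A \<le> hausdorff_measure s A"
    unfolding hausdorff_measure_def by (rule SUP_upper) simp
  then have "hausdorff_pre_measure s 1 A = 0" using A(1) by simp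
  \<comment> \<open>The other half of \<open>e\<close> is kept for enlarging the diameters to
    positive sizes.\<close>
  then have "(INF U\<in>delta_covers 1 A. \<Sum>i. diam_powr s (U i)) < ennreal (e / 2)"
    using \<open>e > 0\<close> unfolding hausdorff_pre_measure_def by simp
  then obtain U where U: "U \<in> delta_covers 1 A" "(\<Sum>i. diam_powr s (U i)) < ennreal (e / 2)"
    unfolding INF_less_iff by blast
  have bdd: "bounded (U i)" and le1: "diameter (U i) \<le> 1" for i
    using U(1) by (auto simp: delta_covers_def)
  have ge0: "diameter (U i) \<ge> 0" for i using bdd by (rule diameter_ge_0)
  have "ennreal (diameter (U i) powr t) \<le> diam_powr s (U i)" for i
  proof (cases "U i = {} \<or> s = 0")
    case True
    have "diameter (U i) powr t \<le> 1 powr t"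
      using ge0 le1 assms by (intro powr_mono2) auto
    then show ?thesis using True assms by (auto simp: diam_powr_def ennreal_leI)
  next
    case False
    then show ?thesis
      using ge0[of i] le1[of i] assms by (auto simp: diam_powr_def intro!: ennreal_leI powr_mono')
  qed
  then have "(\<Sum>i. ennreal (diameter (U i) powr t)) \<le> (\<Sum>i. diam_powr s (U i))"
    by (intro suminf_le) auto
  with U(2) have less: "(\<Sum>i. ennreal (diameter (U i) powr t)) < ennreal (e / 2)" by simp
  have summ: "summable (\<lambda>i. diameter (U i) powr t)"
    using less by (intro summable_suminf_not_top) auto
  then have sum_le: "(\<Sum>i. diameter (U i) powr t) \<le> e / 2"
    using less \<open>e > 0\<close> by (subst (asm) suminf_ennreal2) (auto simp: ennreal_less_iff suminf_nonneg)
  \<comment> \<open>Singletons have diameter \<open>0\<close>, so the diameters are enlarged to positive numbers.\<close>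
  define \<eta> where "\<eta> i = (e / 2 * (1 / 2) ^ Suc i) powr (1 / t)" for i :: nat
  define d where "d i = max (diameter (U i)) (\<eta> i)" for i
  have \<eta>: "\<eta> i > 0" "\<eta> i powr t = e / 2 * (1 / 2) ^ Suc i" for i
    using assms by (auto simp: \<eta>_def powr_powr)
  have half: "(\<lambda>i. e / 2 * (1 / 2) ^ Suc i) sums (e / 2 * 1)"
    by (intro sums_mult power_half_series)
  have d_le: "d i powr t \<le> diameter (U i) powr t + e / 2 * (1 / 2) ^ Suc i" for i
    unfolding d_def \<eta>(2)[symmetric] max_def by simp
  have summ2: "summable (\<lambda>i. diameter (U i) powr t + e / 2 * (1 / 2) ^ Suc i)"
    using summ half by (intro summable_add) (auto simp: sums_iff)
  show thesis
  proof (rule that[of U d])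
    show "A \<subseteq> (\<Union>i. U i)" using U(1) by (auto simp: delta_covers_def)
    show "d i > 0" for i using \<eta>(1)[of i] by (simp add: d_def)
    show "dist x y \<le> d i" if "x \<in> U i" "y \<in> U i" for i x y
      using diameter_bounded_bound[OF bdd that] by (simp add: d_def)
    show summd: "summable (\<lambda>i. d i powr t)"
      by (rule summable_comparison_test'[OF summ2, of 0]) (use d_le in auto)
    have "(\<Sum>i. d i powr t) \<le> (\<Sum>i. diameter (U i) powr t + e / 2 * (1 / 2) ^ Suc i)"
      by (intro suminf_le d_le summd summ2)
    also have "\<dots> = (\<Sum>i. diameter (U i) powr t) + e / 2"
      using summ half by (subst suminf_add[symmetric]) (auto simp: sums_iff)
    finally show "(\<Sum>i. d i powr t) \<le> e" using sum_le by simp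
  qed
qed

text \<open>Compare with the least touched index \<open>a\<close>: if \<open>k\<close> is touched,
  \<open>A\<close> has points at least \<open>(k - a) * g\<close> apart, so \<open>k - a\<close> is
  at most \<open>D / g\<close>. The \<open>Suc\<close> accounts for \<open>a\<close> itself.\<close>

lemma card_touched_le:
  fixes A :: "real set" and B :: "nat \<Rightarrow> real set"
  assumes "g > 0" and sep: "\<And>j k x y. j < k \<Longrightarrow> k < N \<Longrightarrow> x \<in> B j \<Longrightarrow> y \<in> B k \<Longrightarrow> real (k - j) * g \<le> y - x"
    and diam: "\<And>x y. x \<in> A \<Longrightarrow> y \<in> A \<Longrightarrow> dist x y \<le> D" and "D \<ge> 0"
  shows "card {j. j < N \<and> A \<inter> B j \<noteq> {}} \<le> Suc (nat \<lfloor>D / g\<rfloor>)"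
proof (cases "{j. j < N \<and> A \<inter> B j \<noteq> {}} = {}")
  case True
  then show ?thesis by (simp only: True card.empty)
next
  case False
  let ?J = "{j. j < N \<and> A \<inter> B j \<noteq> {}}"
  define a where "a = Min ?J"
  have fin: "finite ?J" by simp
  have a: "a \<in> ?J" unfolding a_def using Min_in[OF fin False] .
  have "?J \<subseteq> {a..a + nat \<lfloor>D / g\<rfloor>}"
  proof
    fix k assume k: "k \<in> ?J"
    then have "a \<le> k" unfolding a_def using fin by (intro Min_le)
    moreover have "k \<le> a + nat \<lfloor>D / g\<rfloor>"
    proof (cases "a < k")
      case True
      obtain x y where xy: "x \<in> A" "x \<in> B a" "y \<in> A" "y \<in> B k" using a k by auto
      have "real (k - a) * g \<le> y - x" using sep[OF True _ xy(2,4)] k by auto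
      also have "\<dots> \<le> D" using diam[OF xy(1,3)] by (simp add: dist_real_def)
      finally have "real (k - a) \<le> D / g" using \<open>g > 0\<close> by (simp add: pos_le_divide_eq)
      then have "k - a \<le> nat \<lfloor>D / g\<rfloor>" by (rule le_nat_floor)
      then show ?thesis by simp
    qed auto
    ultimately show "k \<in> {a..a + nat \<lfloor>D / g\<rfloor>}" by simp
  qed
  then have "card ?J \<le> card {a..a + nat \<lfloor>D / g\<rfloor>}" by (intro card_mono) auto
  then show ?thesis by simp
qed

text \<open>The cutoff at \<open>r\<close> is there because larger sets are avoided outright when an
  interval is selected; only the smaller ones need a budget.\<close>

definition touch_sum :: "(nat \<Rightarrow> real set) \<Rightarrow> (nat \<Rightarrow> real) \<Rightarrow> real \<Rightarrow> real set \<Rightarrow> real \<Rightarrow> real" where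
  "touch_sum U d s I r = (\<Sum>i. if U i \<inter> I \<noteq> {} \<and> d i \<le> r then d i powr s else 0)"

lemma summable_restrict_real:
  fixes f :: "nat \<Rightarrow> real"
  assumes "summable f" "\<And>i. 0 \<le> f i"
  shows "summable (\<lambda>i. if P i then f i else 0)"
  by (rule summable_comparison_test'[OF assms(1), of 0]) (use assms(2) in auto)

text \<open>If every child \<open>B j\<close> violated the conclusion, each would carry weight at least \<open>\<epsilon> r'\<^sup>s\<close>,
  where sets of size in \<open>(r', r]\<close> are given the weight \<open>\<epsilon> r'\<^sup>s\<close>; summing over all children
  counts small sets once and larger ones at most \<open>1 + d/g\<close> times.\<close>

lemma child_selection:
  fixes U :: "nat \<Rightarrow> real set" and B :: "nat \<Rightarrow> real set"
  assumes s: "0 < s" "s \<le> 1" and d: "\<And>i. d i > 0"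
    and diam: "\<And>i x y. x \<in> U i \<Longrightarrow> y \<in> U i \<Longrightarrow> dist x y \<le> d i"
    and summ: "summable (\<lambda>i. d i powr s)"
    and eps: "0 < \<epsilon>" "\<epsilon> \<le> 1" and g: "0 < r'" "r' < g" and r: "0 < r" "r' \<le> r"
    and sep: "\<And>j k x y. j < k \<Longrightarrow> k < N \<Longrightarrow> x \<in> B j \<Longrightarrow> y \<in> B k \<Longrightarrow> real (k - j) * g \<le> y - x"
    and sub: "\<And>j. j < N \<Longrightarrow> B j \<subseteq> I"
    and inv: "touch_sum U d s I r \<le> \<epsilon> * r powr s"
    and N: "(r / r') powr s + \<epsilon> * r / g < real N"
  shows "\<exists>j<N. (\<forall>i. U i \<inter> B j \<noteq> {} \<longrightarrow> d i \<le> r \<longrightarrow> d i \<le> r') \<and> touch_sum U d s (B j) r' \<le> \<epsilon> * r' powr s"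
proof (rule ccontr)
  assume contra: "\<not> ?thesis"
  define u where "u i = (if d i \<le> r' then d i powr s else \<epsilon> * r' powr s)" for i
  have u0: "0 \<le> u i" for i using eps by (simp add: u_def)
  have u_le: "u i \<le> d i powr s" for i
  proof (cases "d i \<le> r'")
    case False
    then have "r' powr s \<le> d i powr s" using g s by (intro powr_mono2) auto
    moreover have "\<epsilon> * r' powr s \<le> 1 * r' powr s" using eps by (intro mult_right_mono) auto
    ultimately show ?thesis using False by (simp add: u_def)
  qed (simp add: u_def)
  have summ_u: "summable u"
    by (rule summable_comparison_test'[OF summ, of 0]) (use u0 u_le in auto)
  define v where "v j i = (if U i \<inter> B j \<noteq> {} \<and> d i \<le> r then u i else 0)" for j i
  have v0: "0 \<le> v j i" for j i using u0 by (simp add: v_def)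
  have summ_v: "summable (v j)" for j
    unfolding v_def by (intro summable_restrict_real summ_u u0)
  \<comment> \<open>A violating child either meets a set of size in \<open>(r', r]\<close>, whose
    weight alone reaches the bound, or meets small sets of too large total weight.\<close>
  have big: "\<epsilon> * r' powr s \<le> (\<Sum>i. v j i)" if j: "j < N" for j
  proof (cases "\<exists>i. U i \<inter> B j \<noteq> {} \<and> d i \<le> r \<and> \<not> d i \<le> r'")
    case True
    then obtain i where i: "U i \<inter> B j \<noteq> {}" "d i \<le> r" "\<not> d i \<le> r'" by blast
    then have "\<epsilon> * r' powr s = v j i" by (simp add: v_def u_def)
    also have "\<dots> \<le> (\<Sum>i. v j i)"
      using sum_le_suminf[OF summ_v, of "{i}" j] v0 by simp
    finally show ?thesis .
  next
    case False
    then have "\<epsilon> * r' powr s \<le> touch_sum U d s (B j) r'"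
      using contra j by (meson le_cases)
    also have "\<dots> \<le> (\<Sum>i. v j i)" unfolding touch_sum_def
    proof (intro suminf_le summ_v summable_restrict_real summ)
      have "U i \<inter> B j \<noteq> {} \<Longrightarrow> d i \<le> r' \<Longrightarrow> d i \<le> r" for i
        using r(2) by simp
      then show "(if U i \<inter> B j \<noteq> {} \<and> d i \<le> r' then d i powr s else 0) \<le> v j i" for i
        using eps by (auto simp: v_def u_def)
    qed auto
    finally show ?thesis .
  qed
  \<comment> \<open>Bounds the overcount relative to \<open>d i powr s\<close>: in the excess
    \<open>\<epsilon> * r' powr s * d i / g\<close> the factor \<open>d i\<close> is at most
    \<open>d i powr s * r powr (1 - s)\<close>, by \<open>s \<le> 1\<close> and
    \<open>d i \<le> r\<close>.\<close>
  define \<kappa> where "\<kappa> = 1 + \<epsilon> * r' powr s * r powr (1 - s) / g"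
  have \<kappa>: "1 \<le> \<kappa>" using eps g by (simp add: \<kappa>_def)
  define w where "w i = (if U i \<inter> I \<noteq> {} \<and> d i \<le> r then d i powr s else 0)" for i
  have pointwise: "(\<Sum>j<N. v j i) \<le> \<kappa> * w i" for i
  proof (cases "U i \<inter> I \<noteq> {} \<and> d i \<le> r")
    case False
    then have "v j i = 0" if "j < N" for j using sub[OF that] by (auto simp: v_def)
    then show ?thesis using False by (auto simp: w_def)
  next
    case True
    let ?J = "{j. j < N \<and> U i \<inter> B j \<noteq> {}}"
    have "(\<Sum>j<N. v j i) = (\<Sum>j\<in>{..<N}. if j \<in> ?J then u i else 0)"
      using True by (intro sum.cong) (auto simp: v_def)
    also have "\<dots> = real (card ?J) * u i"
      by (subst sum.inter_restrict[symmetric]) (auto simp: Int_def conj_commute)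
    also have "\<dots> \<le> real (Suc (nat \<lfloor>d i / g\<rfloor>)) * u i"
    proof (intro mult_right_mono u0 iffD2[OF of_nat_le_iff])
      show "card ?J \<le> Suc (nat \<lfloor>d i / g\<rfloor>)"
        by (rule card_touched_le[OF _ sep diam]) (use g d[of i] in auto)
    qed
    also have "\<dots> \<le> \<kappa> * d i powr s"
    proof (cases "d i \<le> r'")
      case True
      \<comment> \<open>As \<open>r' < g\<close>, a small set meets at most one child.\<close>
      then have "d i / g < 1" "0 \<le> d i / g" using g d[of i] by auto
      then have "nat \<lfloor>d i / g\<rfloor> = 0" by linarith
      then have "real (Suc (nat \<lfloor>d i / g\<rfloor>)) * u i = 1 * d i powr s" using True by (simp add: u_def)
      also have "\<dots> \<le> \<kappa> * d i powr s" using \<kappa> by (intro mult_right_mono) auto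
      finally show ?thesis .
    next
      case False
      have "0 \<le> d i / g" using g d[of i] by simp
      then have "real (Suc (nat \<lfloor>d i / g\<rfloor>)) \<le> 1 + d i / g" by linarith
      then have "real (Suc (nat \<lfloor>d i / g\<rfloor>)) * u i \<le> (1 + d i / g) * u i"
        using u0 by (rule mult_right_mono)
      also have "\<dots> = u i + \<epsilon> * r' powr s * d i / g"
        using False by (simp add: u_def algebra_simps)
      also have "\<dots> \<le> d i powr s + \<epsilon> * r' powr s * (d i powr s * r powr (1 - s)) / g"
      proof -
        have "d i = d i powr s * d i powr (1 - s)" using d[of i] by (simp flip: powr_add)
        also have "\<dots> \<le> d i powr s * r powr (1 - s)"
          using \<open>U i \<inter> I \<noteq> {} \<and> d i \<le> r\<close> d[of i] s by (intro mult_left_mono powr_mono2) auto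
        finally show ?thesis
          using eps g u_le[of i] by (intro add_mono divide_right_mono mult_left_mono) auto
      qed
      also have "\<dots> = \<kappa> * d i powr s" by (simp add: \<kappa>_def algebra_simps)
      finally show ?thesis .
    qed
    finally show ?thesis using True by (simp add: w_def)
  qed
  have summ_w: "summable w" unfolding w_def by (intro summable_restrict_real summ) simp
  have "real N * (\<epsilon> * r' powr s) \<le> (\<Sum>j<N. \<Sum>i. v j i)"
    using sum_mono[of "{..<N}" "\<lambda>_. \<epsilon> * r' powr s" "\<lambda>j. \<Sum>i. v j i"] big by simp
  also have "\<dots> = (\<Sum>i. \<Sum>j<N. v j i)" using summ_v by (intro suminf_sum[symmetric]) auto
  also have "\<dots> \<le> (\<Sum>i. \<kappa> * w i)"
    by (intro suminf_le pointwise summable_sum summ_v summable_mult summ_w)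
  also have "\<dots> = \<kappa> * touch_sum U d s I r"
    unfolding touch_sum_def w_def[symmetric] by (rule suminf_mult[OF summ_w])
  also have "\<dots> \<le> \<kappa> * (\<epsilon> * r powr s)" using inv \<kappa> by (intro mult_left_mono) auto
  \<comment> \<open>Here \<open>r powr (1 - s)\<close> from \<open>\<kappa>\<close> and
    \<open>r powr s\<close> combine to \<open>r\<close>; the second factor is exactly the bound that
    \<open>N\<close> exceeds.\<close>
  also have "\<dots> = (\<epsilon> * r' powr s) * ((r / r') powr s + \<epsilon> * r / g)"
  proof -
    have "r powr (1 - s) * r powr s = r" using r by (simp flip: powr_add)
    moreover have "(r / r') powr s = r powr s / r' powr s" using r g by (simp add: powr_divide)
    moreover have "r' powr s > 0" using g by simp
    ultimately show ?thesis unfolding \<kappa>_def by (simp add: field_simps)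
  qed
  finally have "(\<epsilon> * r' powr s) * real N \<le> (\<epsilon> * r' powr s) * ((r / r') powr s + \<epsilon> * r / g)"
    by (simp add: mult.commute)
  moreover have "0 < \<epsilon> * r' powr s" using eps g by simp
  ultimately show False using N by (simp add: mult_le_cancel_left_pos)
qed

text \<open>A grid whose mesh is a multiple of \<open>lam ^ n\<close> has of order
  \<open>r / lam ^ n\<close> cells in the interval, and density puts a value near each midpoint. By
  \<open>2 powr (\<alpha> * s) * lam < 1\<close>, the term \<open>(r / r') powr s\<close> is of
  smaller order, so \<open>child_selection\<close> applies for large \<open>n\<close>.\<close>

lemma nested_step:
  fixes U :: "nat \<Rightarrow> real set"
  assumes lam: "1 / 2 < lam" "lam < 1" and \<alpha>: "\<alpha> > 1" and s: "0 < s" "s \<le> 1"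
    and q: "2 powr (\<alpha> * s) * lam < 1" and d: "\<And>i. d i > 0"
    and diam: "\<And>i x y. x \<in> U i \<Longrightarrow> y \<in> U i \<Longrightarrow> dist x y \<le> d i"
    and summ: "summable (\<lambda>i. d i powr s)"
    and r: "0 < r" and sub: "{a..a + r} \<subseteq> I_set lam"
    and inv: "touch_sum U d s {a..a + r} r \<le> 1 / 16 * r powr s"
  shows "\<exists>n\<ge>k. \<exists>y\<in>digit_sums lam n. \<exists>a' r'. r' = 2 powr (- (real n * \<alpha>)) \<and> a' = y - r' / 2 \<and>
    {a'..a' + r'} \<subseteq> {a..a + r} \<and> (\<forall>i. U i \<inter> {a'..a' + r'} \<noteq> {} \<longrightarrow> d i \<le> r \<longrightarrow> d i \<le> r') \<and>
    touch_sum U d s {a'..a' + r'} r' \<le> 1 / 16 * r' powr s"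
proof -
  define L where "L = lam / (1 - lam)"
  have L: "L > 0" using lam by (simp add: L_def)
  define Q where "Q = 2 powr (\<alpha> * s) * lam"
  have Q: "0 < Q" "Q < 1" using q lam by (auto simp: Q_def)
  define p where "p = 2 powr (- \<alpha>) / lam"
  have "2 powr (- \<alpha>) < 2 powr (- 1 :: real)" using \<alpha> by (intro powr_less_mono) auto
  then have p: "0 < p" "p < 1" using lam by (auto simp: p_def)
  have "(\<lambda>n. 8 * L * lam ^ n) \<longlonglongrightarrow> 8 * L * 0"
    using lam by (intro tendsto_intros LIMSEQ_realpow_zero) auto
  then have "eventually (\<lambda>n. 8 * L * lam ^ n < r) sequentially"
    using r by (intro order_tendstoD) auto
  moreover have "(\<lambda>n. 16 * L * r powr s * Q ^ n) \<longlonglongrightarrow> 16 * L * r powr s * 0"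
    using Q by (intro tendsto_intros LIMSEQ_realpow_zero) auto
  then have "eventually (\<lambda>n. 16 * L * r powr s * Q ^ n < r) sequentially"
    using r by (intro order_tendstoD) auto
  moreover have "eventually (\<lambda>n. p ^ n < L) sequentially"
    using p L LIMSEQ_realpow_zero[of p] by (intro order_tendstoD) auto
  moreover have "eventually (\<lambda>n. n \<ge> k) sequentially" by (rule eventually_ge_at_top)
  ultimately have "eventually (\<lambda>n. 8 * L * lam ^ n < r \<and> 16 * L * r powr s * Q ^ n < r \<and>
      p ^ n < L \<and> n \<ge> k) sequentially" by eventually_elim auto
  \<comment> \<open>For \<open>h\<close> and \<open>r'\<close> as defined next, the first three
    conditions amount to \<open>2 * h < r\<close>, \<open>(r / r') powr s < r / (4 * h)\<close> and
    \<open>r' < h / 4\<close>. The 4 in \<open>h\<close> makes the error of density equal to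
    \<open>h / 4\<close>.\<close>
  then obtain n where n: "8 * L * lam ^ n < r" "16 * L * r powr s * Q ^ n < r" "p ^ n < L" "n \<ge> k"
    by (auto simp: eventually_sequentially)
  define h where "h = 4 * L * lam ^ n"
  define r' where "r' = 2 powr (- (real n * \<alpha>))"
  have h: "0 < h" "2 * h < r" using L lam n(1) by (auto simp: h_def)
  have r'0: "0 < r'" by (simp add: r'_def)
  have "r' = p ^ n * lam ^ n"
    using lam by (simp add: r'_def p_def power_divide powr_power mult.commute)
  then have r'h: "r' < h / 4" using n(3) lam by (simp add: h_def)
  define N where "N = nat \<lfloor>r / h\<rfloor>"
  have "2 < r / h" using h by (simp add: field_simps)
  then have N: "real N \<le> r / h" "r / h - 1 < real N" "r / (2 * h) < real N"
    unfolding N_def by linarith+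
  have Nh: "real N * h \<le> r" using N(1) h by (simp add: pos_le_divide_eq)
  define x where "x j = a + (real j + 1 / 2) * h" for j
  have jh: "real j * h + h \<le> r" if "j < N" for j
  proof -
    have "(real j + 1) * h \<le> real N * h" using that h by (intro mult_right_mono) auto
    then show ?thesis using Nh by (simp add: algebra_simps)
  qed
  have "\<exists>y\<in>digit_sums lam n. \<bar>x j - y\<bar> \<le> h / 4" if "j < N" for j
  proof -
    have "x j \<in> {a..a + r}" using jh[OF that] h by (simp add: x_def algebra_simps)
    then have "0 \<le> x j" "x j \<le> L" using sub by (auto simp: I_set_def L_def)
    moreover have "h / 4 = L * lam ^ n" by (simp add: h_def)
    ultimately show ?thesis
      using digit_sums_dense[of lam "x j" n, folded L_def] lam by (simp only: less_imp_le)
  qed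
  then obtain y where y: "\<And>j. j < N \<Longrightarrow> y j \<in> digit_sums lam n" "\<And>j. j < N \<Longrightarrow> \<bar>x j - y j\<bar> \<le> h / 4"
    by metis
  \<comment> \<open>The radius \<open>r' / 2\<close> is half of that in \<open>W_set\<close>, so all
    points of the closed interval satisfy the strict inequality there.\<close>
  define B where "B j = {y j - r' / 2..(y j - r' / 2) + r'}" for j
  have B_sub: "B j \<subseteq> {a..a + r}" if "j < N" for j
  proof -
    have "x j = a + real j * h + h / 2" "0 \<le> real j * h" using h by (auto simp: x_def algebra_simps)
    then have "a \<le> y j - r' / 2" "y j - r' / 2 + r' \<le> a + r"
      using y(2)[OF that] jh[OF that] h r'h unfolding abs_le_iff by linarith+
    then show ?thesis by (auto simp: B_def)
  qed
  have "\<exists>j<N. (\<forall>i. U i \<inter> B j \<noteq> {} \<longrightarrow> d i \<le> r \<longrightarrow> d i \<le> r') \<and> touch_sum U d s (B j) r' \<le> 1 / 16 * r' powr s"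
  \<comment> \<open>Distinct midpoints are at least \<open>h\<close> apart; two errors of
    \<open>h / 4\<close> and two radii below \<open>h / 8\<close> leave a gap of
    \<open>h / 4\<close>.\<close>
  proof (rule child_selection[where g = "h / 4"])
    fix j k u v assume jk: "j < k" "k < N" "u \<in> B j" "v \<in> B k"
    have "real (k - j) * h \<ge> 1 * h" using jk(1) h by (intro mult_right_mono) auto
    moreover have "x k - x j = real (k - j) * h" using jk(1) by (simp add: x_def algebra_simps of_nat_diff)
    moreover have "u \<le> x j + h / 4 + r' / 2" "x k - h / 4 - r' / 2 \<le> v"
      using jk y(2)[of j] y(2)[of k] unfolding B_def abs_le_iff by auto
    ultimately show "real (k - j) * (h / 4) \<le> v - u" using r'h by simp
  next
    have "(r / r') powr s = r powr s * (2 powr (\<alpha> * s)) ^ n"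
    proof -
      have "r / r' = r * 2 powr (real n * \<alpha>)" by (simp add: r'_def powr_minus_divide)
      then show ?thesis using r by (simp add: powr_mult powr_powr powr_power mult_ac)
    qed
    then have "(r / r') powr s * (4 * h) = 16 * L * r powr s * Q ^ n"
      by (simp add: h_def Q_def power_mult_distrib)
    then have "(r / r') powr s * (4 * h) < r" using n(2) by linarith
    then have "(r / r') powr s < r / (4 * h)" using h by (simp add: pos_less_divide_eq)
    \<comment> \<open>The constant 1/16 makes the second summand equal to
      \<open>r / (4 * h)\<close>, half of the available \<open>r / (2 * h)\<close>.\<close>
    then have "(r / r') powr s + 1 / 16 * r / (h / 4) < r / (4 * h) + r / (4 * h)"
      by (rule add_less_le_mono) simp
    also have "\<dots> = r / (2 * h)" by simp
    also note N(3)
    finally show "(r / r') powr s + 1 / 16 * r / (h / 4) < real N" .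
  qed (use s d diam summ r'0 r'h r h inv B_sub in auto)
  then obtain j where j: "j < N" "\<forall>i. U i \<inter> B j \<noteq> {} \<longrightarrow> d i \<le> r \<longrightarrow> d i \<le> r'"
    "touch_sum U d s (B j) r' \<le> 1 / 16 * r' powr s" by blast
  define a' where "a' = y j - r' / 2"
  have "r' = 2 powr (- (real n * \<alpha>)) \<and> a' = y j - r' / 2 \<and> {a'..a' + r'} \<subseteq> {a..a + r} \<and>
      (\<forall>i. U i \<inter> {a'..a' + r'} \<noteq> {} \<longrightarrow> d i \<le> r \<longrightarrow> d i \<le> r') \<and>
      touch_sum U d s {a'..a' + r'} r' \<le> 1 / 16 * r' powr s"
    using j B_sub[OF j(1)] unfolding B_def a'_def by (simp add: r'_def)
  then show ?thesis using n(4) y(1)[OF j(1)] by blast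
qed

text \<open>A covering set containing the common point of the nested intervals would have size at
  most every interval length, hence at most 0.\<close>

lemma hausdorff_measure_W_set_neq_0:
  assumes lam: "1 / 2 < lam" "lam < 1" and \<alpha>: "\<alpha> > 1" and s: "0 \<le> s" "s < t" "t \<le> 1"
    and q: "2 powr (\<alpha> * t) * lam < 1"
  shows "hausdorff_measure s (W_set lam \<alpha>) \<noteq> 0"
proof
  assume zero: "hausdorff_measure s (W_set lam \<alpha>) = 0"
  obtain U d where cov: "W_set lam \<alpha> \<subseteq> (\<Union>i. U i)" and d: "\<And>i. d i > 0"
    and diam: "\<And>i x y. x \<in> U i \<Longrightarrow> y \<in> U i \<Longrightarrow> dist x y \<le> d i"
    and summ: "summable (\<lambda>i. d i powr t)" and le: "(\<Sum>i. d i powr t) \<le> 1 / 16"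
    by (rule hausdorff_measure_eq_0D[OF zero s(1,2), of "1 / 16"]) (simp, simp, rule that, assumption+)
  have t: "0 < t" using s by simp
  define J where "J z = {fst z..fst z + snd z}" for z :: "real \<times> real"
  define P where "P z \<longleftrightarrow> 0 < snd z \<and> J z \<subseteq> I_set lam \<and>
      touch_sum U d t (J z) (snd z) \<le> 1 / 16 * snd z powr t" for z
  \<comment> \<open>The stage \<open>k\<close> enters the relation to force
    \<open>n \<ge> k\<close>: the common point is then approximated at infinitely many levels and
    the lengths tend to 0.\<close>
  define R where "R k z z' \<longleftrightarrow> J z' \<subseteq> J z \<and> (\<forall>i. U i \<inter> J z' \<noteq> {} \<longrightarrow> d i \<le> snd z \<longrightarrow> d i \<le> snd z') \<and>
      (\<exists>n\<ge>k. \<exists>y\<in>digit_sums lam n. snd z' = 2 powr (- (real n * \<alpha>)) \<and> fst z' = y - snd z' / 2)" for k :: nat and z z'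
  have "\<exists>z. \<forall>k. (P (z k) \<and> (k = 0 \<longrightarrow> z k = (0, 1))) \<and> R k (z k) (z (Suc k))"
  proof (rule dependent_nat_choice)
    \<comment> \<open>The unit interval lies in \<open>I_set lam\<close> since
      \<open>lam > 1 / 2\<close>, and its budget at length 1 is the total weight 1/16 granted to the
      cover.\<close>
    have "touch_sum U d t {0..1} 1 \<le> (\<Sum>i. d i powr t)"
      unfolding touch_sum_def by (intro suminf_le summable_restrict_real summ) auto
    then have "P (0, 1)" using le lam by (simp add: P_def J_def I_set_def field_simps)
    then show "\<exists>z. P z \<and> (0 = (0::nat) \<longrightarrow> z = (0, 1))" by blast
  next
    fix z :: "real \<times> real" and k :: nat assume "P z \<and> (k = 0 \<longrightarrow> z = (0, 1))"
    then have z: "0 < snd z" "{fst z..fst z + snd z} \<subseteq> I_set lam"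
      "touch_sum U d t {fst z..fst z + snd z} (snd z) \<le> 1 / 16 * snd z powr t"
      by (auto simp: P_def J_def)
    from nested_step[OF lam \<alpha> t s(3) q d diam summ z, of k] obtain n y a' r' where
      n: "n \<ge> k" "y \<in> digit_sums lam n" "r' = 2 powr (- (real n * \<alpha>))" "a' = y - r' / 2"
        "J (a', r') \<subseteq> J z" "\<forall>i. U i \<inter> J (a', r') \<noteq> {} \<longrightarrow> d i \<le> snd z \<longrightarrow> d i \<le> r'"
        "touch_sum U d t (J (a', r')) r' \<le> 1 / 16 * r' powr t"
      unfolding J_def fst_conv snd_conv by blast
    have "P (a', r')" using n z(2) by (auto simp: P_def J_def[of z])
    moreover have "R k z (a', r')" unfolding R_def fst_conv snd_conv using n by blast
    ultimately show "\<exists>y. (P y \<and> (Suc k = 0 \<longrightarrow> y = (0, 1))) \<and> R k z y" by blast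
  qed
  then obtain z where P: "\<And>k. P (z k)" and z0: "z 0 = (0, 1)" and R: "\<And>k. R k (z k) (z (Suc k))"
    by blast
  have "decseq (\<lambda>k. J (z k))" using R by (intro decseq_SucI) (simp add: R_def)
  moreover have "compact (J (z k))" "J (z k) \<noteq> {}" for k
    using P[of k] by (auto simp: J_def P_def)
  ultimately have "(\<Inter>k. J (z k)) \<noteq> {}"
    by (intro compact_nest) (auto dest: decseqD)
  then obtain x where x: "\<And>k. x \<in> J (z k)" by blast
  have "x \<in> W_set lam \<alpha>"
    unfolding mem_W_set
  proof
    fix k
    obtain n y where n: "n \<ge> k" "y \<in> digit_sums lam n" "snd (z (Suc k)) = 2 powr (- (real n * \<alpha>))"
      "fst (z (Suc k)) = y - snd (z (Suc k)) / 2" using R[of k] unfolding R_def by blast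
    have "\<bar>x - y\<bar> < 2 powr (- (real n * \<alpha>))"
      using x[of "Suc k"] P[of "Suc k"] unfolding J_def P_def n(3)[symmetric] n(4) by auto
    moreover have "x \<in> I_set lam" using x[of 0] P[of 0] by (auto simp: P_def)
    ultimately show "\<exists>n\<ge>k. x \<in> I_set lam \<and> (\<exists>y\<in>digit_sums lam n. \<bar>x - y\<bar> < 2 powr (- (real n * \<alpha>)))"
      using n(1,2) by blast
  qed
  then obtain i where i: "x \<in> U i" using cov by blast
  \<comment> \<open>Weight at most 1/16 forces size at most 1; each selection then passes the bound
    on to the next length.\<close>
  have small: "d i \<le> snd (z k)" for k
  proof (induction k)
    case 0
    have "d i powr t \<le> (\<Sum>i. d i powr t)" using sum_le_suminf[OF summ, of "{i}"] by simp
    then have "d i powr t \<le> 1 powr t" using le by simp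
    then have "d i \<le> 1" using t powr_less_mono2[of t 1 "d i"] by linarith
    then show ?case using z0 by simp
  next
    case (Suc k)
    then show ?case using R[of k] i x[of "Suc k"] unfolding R_def by blast
  qed
  have "snd (z (Suc k)) \<le> (1 / 2) ^ k" for k
  proof -
    obtain n where n: "n \<ge> k" "snd (z (Suc k)) = 2 powr (- (real n * \<alpha>))"
      using R[of k] unfolding R_def by blast
    have "real k \<le> real n * \<alpha>" using n(1) \<alpha> mult_mono[of "real k" "real n" 1 \<alpha>] by simp
    then have "2 powr (- (real n * \<alpha>)) \<le> 2 powr (- real k)" by simp
    also have "\<dots> = (1 / 2) ^ k" by (simp add: powr_minus_divide powr_realpow power_one_over)
    finally show ?thesis using n(2) by simp
  qed
  then have "d i \<le> (1 / 2) ^ k" for k using small order_trans by blast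
  then have "d i \<le> 0" by (intro LIMSEQ_le_const[OF LIMSEQ_realpow_zero[of "1 / 2"]]) auto
  then show False using d[of i] by simp
qed

section \<open>Range of the parameter and the dimension formula\<close>

text \<open>The first two terms give \<open>lam + lam ^ 2 \<le> 1\<close>; for
  \<open>lam \<le> 1 / 2\<close> the sum would be at most \<open>1 - (1 / 2) ^ m\<close>.\<close>

lemma multinacci_bounds:
  fixes lam :: real
  assumes "m \<ge> 2" "lam > 0" "(\<Sum>k=1..m. lam ^ k) = 1"
  shows "1 / 2 < lam" "lam < 1"
proof -
  have geo: "(\<Sum>k=1..m. x ^ k) = x * (\<Sum>k<m. x ^ k)" for x :: real
    by (simp add: sum_distrib_left sum.atLeast1_atMost_eq)
  have "lam + lam ^ 2 \<le> (\<Sum>k=1..m. lam ^ k)"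
    using sum_mono2[of "{1..m}" "{1, 2}" "\<lambda>k. lam ^ k"] assms by simp
  then show "lam < 1" using assms by (smt (verit) zero_less_power)
  show "1 / 2 < lam"
  proof (rule ccontr)
    assume "\<not> 1 / 2 < lam"
    then have "(\<Sum>k=1..m. lam ^ k) \<le> (\<Sum>k=1..m. (1 / 2) ^ k)"
      using assms by (intro sum_mono power_mono) auto
    also have "\<dots> = 1 - (1 / 2) ^ m" by (subst geo, subst sum_gp_strict) simp
    also have "\<dots> < 1" by simp
    finally show False using assms by simp
  qed
qed

theorem theorem5:
  fixes m :: nat and lam \<alpha> :: real
  assumes "m \<ge> 2"
    and "lam > 0"
    and "(\<Sum>k=1..m. lam ^ k) = 1"
    and "\<alpha> > 1"
  shows "hausdorff_dim (W_set lam \<alpha>) = ereal (- (ln lam / ln 2) * (1 / \<alpha>))"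
proof -
  have lam: "1 / 2 < lam" "lam < 1" using multinacci_bounds assms(1-3) by blast+
  define s\<^sub>0 where "s\<^sub>0 = - (ln lam / ln 2) * (1 / \<alpha>)"
  \<comment> \<open>In this form the conditions of the two bounds become sign conditions on
    exponents, satisfied for \<open>s > s\<^sub>0\<close> and \<open>t < s\<^sub>0\<close>
    respectively.\<close>
  have lam_eq: "lam = 2 powr (- (\<alpha> * s\<^sub>0))"
    using lam assms(4) by (simp add: s\<^sub>0_def powr_def)
  have "ln lam < 0" using lam by simp
  then have s0_pos: "0 < s\<^sub>0" using assms(4) by (simp add: s\<^sub>0_def divide_neg_pos)
  \<comment> \<open>From \<open>lam > 1 / 2\<close> follows \<open>\<alpha> * s\<^sub>0 < 1\<close>,
    so exponents below \<open>s\<^sub>0\<close> meet the requirement \<open>t \<le> 1\<close> of the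
    lower bound.\<close>
  have "2 powr (- 1 :: real) < 2 powr (- (\<alpha> * s\<^sub>0))" using lam(1) unfolding lam_eq[symmetric] by (simp add: powr_minus_divide)
  then have "- 1 < - (\<alpha> * s\<^sub>0)" by (rule powr_less_cancel) simp
  then have "\<alpha> * s\<^sub>0 < 1" by simp
  moreover have "1 * s\<^sub>0 \<le> \<alpha> * s\<^sub>0" using assms(4) s0_pos by (intro mult_right_mono) auto
  ultimately have s0_le: "s\<^sub>0 \<le> 1" by simp
  let ?D = "{ereal s |s. 0 \<le> s \<and> hausdorff_measure s (W_set lam \<alpha>) = 0}"
  have "Inf ?D = ereal s\<^sub>0"
  proof (rule antisym)
    show "Inf ?D \<le> ereal s\<^sub>0"
    proof (rule ereal_le_epsilon2)
      fix e :: real assume "0 < e"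
      have "2 powr (- (\<alpha> * (s\<^sub>0 + e))) / lam = 2 powr (- (\<alpha> * e))"
        unfolding lam_eq by (simp flip: powr_diff add: algebra_simps)
      also have "\<dots> < 1" using assms(4) \<open>0 < e\<close> by (simp add: powr_less_one)
      finally have "hausdorff_measure (s\<^sub>0 + e) (W_set lam \<alpha>) = 0"
        using lam assms s0_pos \<open>0 < e\<close> by (intro hausdorff_measure_W_set_eq_0[of lam m]) auto
      then have "ereal (s\<^sub>0 + e) \<in> ?D" using s0_pos \<open>0 < e\<close> by force
      then have "Inf ?D \<le> ereal (s\<^sub>0 + e)" by (rule Inf_lower)
      then show "Inf ?D \<le> ereal s\<^sub>0 + ereal e" by simp
    qed
    show "ereal s\<^sub>0 \<le> Inf ?D"
    proof (rule Inf_greatest, clarify)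
      fix s assume s: "0 \<le> s" "hausdorff_measure s (W_set lam \<alpha>) = 0"
      show "ereal s\<^sub>0 \<le> ereal s"
      proof (rule ccontr)
        assume "\<not> ereal s\<^sub>0 \<le> ereal s"
        then obtain t where t: "s < t" "t < s\<^sub>0" using dense[of s s\<^sub>0] by auto
        have "2 powr (\<alpha> * t) * lam = 2 powr (\<alpha> * (t - s\<^sub>0))"
          unfolding lam_eq by (simp flip: powr_add add: algebra_simps)
        also have "\<dots> < 1" using assms(4) t by (simp add: powr_less_one mult_pos_neg)
        finally show False
          using hausdorff_measure_W_set_neq_0[OF lam assms(4) s(1) t(1)] s t s0_le by auto
      qed
    qed
  qed
  then show ?thesis by (simp add: hausdorff_dim_def s\<^sub>0_def)
qed

end
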